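(* For $h_0>h_0^\star$ let $(\theta_{1,h_0},\theta_{2,h_0},s_{h_0},r_{h_0})$ be the similarity solution (S) of the convective problem (P) with heat transfer coefficient $h_0$, and let $(\theta_{1,\infty},\theta_{2,\infty},s_\infty,r_\infty)$ be the similarity solution (S$_\infty$) of the problem (P$^\star$)$_\infty$ with temperature boundary condition $\theta_1(0,t)=-D_\infty$. Then, as $h_0\to\infty$, the solution (S) converges pointwise to the solution (S$_\infty$). Moreover, as $h_0\to\infty$, $$\theta_{1,h_0}(x,t)-\theta_{1,\infty}(x,t)=\mathcal O\left(\tfrac1{h_0}\right)\quad\forall\,x>0,\ t>0,$$ $$\theta_{2,h_0}(x,t)-\theta_{2,\infty}(x,t)=\mathcal O\left(\tfrac1{h_0}\right)\quad\forall\,x>0,\ t>0,$$ $$s_{h_0}(t)-s_\infty(t)=\mathcal O\left(\tfrac1{h_0}\right)\quad\forall\,t>0,$$ $$r_{h_0}(t)-r_\infty(t)=\mathcal O\left(\tfrac1{h_0}\right)\quad\forall\,t>0.$$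
   Context: Parameters: $\rho,k_1,k_2,c_1,c_2,l,\gamma,\theta_0,D_\infty>0$ and $0<\epsilon<1$ are fixed real constants, while $h_0>0$ varies; $\alpha_i=\frac{k_i}{\rho c_i}$ for $i=1,2$, and $\alpha_{12}=\frac{\alpha_1}{\alpha_2}$. As usual $\operatorname{erf}(x)=\frac{2}{\sqrt\pi}\int_0^x e^{-y^2}\,dy$ and $\operatorname{erfc}=1-\operatorname{erf}$. Common equations (C): $\alpha_1\theta_{1,xx}=\theta_{1,t}$ for $0<x<s(t)$, $t>0$; $\alpha_2\theta_{2,xx}=\theta_{2,t}$ for $x>r(t)$, $t>0$; $s(0)=r(0)=0$; $\theta_1(s(t),t)=\theta_2(r(t),t)=0$ for $t>0$; $\theta_2(x,0)=\theta_2(+\infty,t)=\theta_0$ for $x>0,t>0$; $k_1\theta_{1,x}(s(t),t)-k_2\theta_{2,x}(r(t),t)=\rho l[\epsilon\dot s(t)+(1-\epsilon)\dot r(t)]$ for $t>0$; $\theta_{1,x}(s(t),t)(r(t)-s(t))=\gamma$ for $t>0$. Problem (P): (C) together with $k_1\theta_{1,x}(0,t)=\frac{h_0}{\sqrt t}(\theta_1(0,t)+D_\infty)$ for $t>0$. Problem (P$^\star$)$_\infty$: (C) together with $\theta_1(0,t)=-D_\infty$ for $t>0$. Functions for (P), $x>0$: $$W_{h_0}(x)=x+\frac{\gamma\sqrt\pi}{2D_\infty}e^{x^2}\left(\operatorname{erf}(x)+\frac{k_1}{h_0\sqrt{\alpha_1\pi}}\right),$$ $$F_{h_0}(x)=\frac{e^{-x^2}}{\operatorname{erf}(x)+\frac{k_1}{h_0\sqrt{\alpha_1\pi}}}-\frac{\theta_0\sqrt{k_2c_2}}{D_\infty\sqrt{k_1c_1}}\frac{\exp(-\alpha_{12}W_{h_0}^2(x))}{\operatorname{erfc}(\sqrt{\alpha_{12}}W_{h_0}(x))},$$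 $$G_{h_0}(x)=x+\frac{(1-\epsilon)\gamma\sqrt\pi}{2D_\infty}e^{x^2}\left(\operatorname{erf}(x)+\frac{k_1}{h_0\sqrt{\alpha_1\pi}}\right).$$ Functions $W_\infty,F_\infty,G_\infty$ for (P$^\star$)$_\infty$: the same formulas with the term $\frac{k_1}{h_0\sqrt{\alpha_1\pi}}$ replaced by $0$ (and $W_{h_0}$ by $W_\infty$ in $F_\infty$). Threshold: $h_0^\star=\frac{\gamma k_1}{2D_\infty\eta\sqrt{\alpha_2}}$, where $\eta$ is the only positive zero of $F_3(x)=\frac{e^{-x^2}}{\operatorname{erfc}(x)}-\frac{\gamma k_1\sqrt\pi}{2\theta_0k_2}\frac1x+\frac{(1-\epsilon)l\sqrt\pi}{\theta_0c_2}x$, $x>0$. For $h_0>h_0^\star$ let $\xi_{h_0}$ be the only positive solution of $F_{h_0}(x)=\frac{l\sqrt\pi}{D_\infty c_1}G_{h_0}(x)$ and $\mu_{h_0}=\sqrt{\alpha_{12}}W_{h_0}(\xi_{h_0})$. Let $\xi_\infty$ be the only positive solution of $F_\infty(x)=\frac{l\sqrt\pi}{D_\infty c_1}G_\infty(x)$ and $\mu_\infty=\sqrt{\alpha_{12}}W_\infty(\xi_\infty)$. Solution (S): $$\theta_{1,h_0}(x,t)=-\frac{D_\infty\operatorname{erf}(\xi_{h_0})}{\operatorname{erf}(\xi_{h_0})+\frac{k_1}{h_0\sqrt{\pi\alpha_1}}}\left(1-\frac{\operatorname{erf}(x/(2\sqrt{\alpha_1t}))}{\operatorname{erf}(\xi_{h_0})}\right),$$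 $$\theta_{2,h_0}(x,t)=\frac{\theta_0\operatorname{erf}(\mu_{h_0})}{\operatorname{erfc}(\mu_{h_0})}\left(\frac{\operatorname{erf}(x/(2\sqrt{\alpha_2t}))}{\operatorname{erf}(\mu_{h_0})}-1\right),$$ $s_{h_0}(t)=2\xi_{h_0}\sqrt{\alpha_1t}$, $r_{h_0}(t)=2\mu_{h_0}\sqrt{\alpha_2t}$. Solution (S$_\infty$): $$\theta_{1,\infty}(x,t)=-D_\infty\left(1-\frac{\operatorname{erf}(x/(2\sqrt{\alpha_1t}))}{\operatorname{erf}(\xi_\infty)}\right),\quad \theta_{2,\infty}(x,t)=\frac{\theta_0\operatorname{erf}(\mu_\infty)}{\operatorname{erfc}(\mu_\infty)}\left(\frac{\operatorname{erf}(x/(2\sqrt{\alpha_2t}))}{\operatorname{erf}(\mu_\infty)}-1\right),$$ $s_\infty(t)=2\xi_\infty\sqrt{\alpha_1t}$, $r_\infty(t)=2\mu_\infty\sqrt{\alpha_2t}$. Physically $\theta_1$ is the temperature for $0<x<s(t)$ and $\theta_2$ for $x>r(t)$; in the comparison of the two solutions, the temperature functions $\theta_{1,h_0},\theta_{2,h_0}$ and $\theta_{1,\infty},\theta_{2,\infty}$ are taken to be defined for all $x>0$, $t>0$ by the explicit error-function formulas given for them in the definitions of (S) and (S$_\infty$), respectively. The $\mathcal O$ estimates are for each fixed $(x,t)$ (respectively each fixed $t$). *)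

theory Defs
  imports "HOL-Analysis.Analysis" "HOL-Library.Landau_Symbols"
begin

text \<open>The oriented interval integral makes this the usual odd function on the whole line.\<close>

definition erf :: "real \<Rightarrow> real" where
  "erf x = 2 / sqrt pi * (LBINT y=0..x. exp (- (y\<^sup>2)))"

definition erfc :: "real \<Rightarrow> real" where
  "erfc x = 1 - erf x"

text \<open>The physical constants of the problem; \<open>latent\<close> is the latent heat $l$ and
  \<open>D\<close> is $D_{\infty}$. The heat transfer coefficient $h_0$ is not among them, since it varies.\<close>

record params =
  \<rho> :: real
  k\<^sub>1 :: real
  k\<^sub>2 :: real
  c\<^sub>1 :: real
  c\<^sub>2 :: real
  latent :: real
  \<gamma> :: real
  \<epsilon> :: real
  \<theta>\<^sub>0 :: real
  D :: real

definition admissible :: "params \<Rightarrow> bool" where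
  "admissible p \<longleftrightarrow>
     \<rho> p > 0 \<and> k\<^sub>1 p > 0 \<and> k\<^sub>2 p > 0 \<and> c\<^sub>1 p > 0 \<and> c\<^sub>2 p > 0 \<and> latent p > 0 \<and> \<gamma> p > 0 \<and>
     \<theta>\<^sub>0 p > 0 \<and> D p > 0 \<and> 0 < \<epsilon> p \<and> \<epsilon> p < 1"

definition \<alpha>\<^sub>1 :: "params \<Rightarrow> real" where
  "\<alpha>\<^sub>1 p = k\<^sub>1 p / (\<rho> p * c\<^sub>1 p)"

definition \<alpha>\<^sub>2 :: "params \<Rightarrow> real" where
  "\<alpha>\<^sub>2 p = k\<^sub>2 p / (\<rho> p * c\<^sub>2 p)"

definition \<alpha>\<^sub>1\<^sub>2 :: "params \<Rightarrow> real" where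
  "\<alpha>\<^sub>1\<^sub>2 p = \<alpha>\<^sub>1 p / \<alpha>\<^sub>2 p"

text \<open>The functions $W$, $F$, $G$ occur in two versions that differ only in one additive term
  \<open>\<delta>\<close>: for the convective problem it is \<open>conv_term p h\<close>, for the problem with the temperature
  condition it is \<open>0\<close>.\<close>

definition conv_term :: "params \<Rightarrow> real \<Rightarrow> real" where
  "conv_term p h = k\<^sub>1 p / (h * sqrt (\<alpha>\<^sub>1 p * pi))"

definition W :: "params \<Rightarrow> real \<Rightarrow> real \<Rightarrow> real" where
  "W p \<delta> x = x + \<gamma> p * sqrt pi / (2 * D p) * exp (x\<^sup>2) * (erf x + \<delta>)"

definition F :: "params \<Rightarrow> real \<Rightarrow> real \<Rightarrow> real" where
  "F p \<delta> x = exp (- (x\<^sup>2)) / (erf x + \<delta>)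
     - \<theta>\<^sub>0 p * sqrt (k\<^sub>2 p * c\<^sub>2 p) / (D p * sqrt (k\<^sub>1 p * c\<^sub>1 p))
       * (exp (- (\<alpha>\<^sub>1\<^sub>2 p * (W p \<delta> x)\<^sup>2)) / erfc (sqrt (\<alpha>\<^sub>1\<^sub>2 p) * W p \<delta> x))"

definition G :: "params \<Rightarrow> real \<Rightarrow> real \<Rightarrow> real" where
  "G p \<delta> x = x + (1 - \<epsilon> p) * \<gamma> p * sqrt pi / (2 * D p) * exp (x\<^sup>2) * (erf x + \<delta>)"

definition F\<^sub>3 :: "params \<Rightarrow> real \<Rightarrow> real" where
  "F\<^sub>3 p x = exp (- (x\<^sup>2)) / erfc x
     - \<gamma> p * k\<^sub>1 p * sqrt pi / (2 * \<theta>\<^sub>0 p * k\<^sub>2 p) * (1 / x)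
     + (1 - \<epsilon> p) * latent p * sqrt pi / (\<theta>\<^sub>0 p * c\<^sub>2 p) * x"

definition \<eta> :: "params \<Rightarrow> real" where
  "\<eta> p = (THE x. x > 0 \<and> F\<^sub>3 p x = 0)"

definition h_star :: "params \<Rightarrow> real" where
  "h_star p = \<gamma> p * k\<^sub>1 p / (2 * D p * \<eta> p * sqrt (\<alpha>\<^sub>2 p))"

definition \<xi> :: "params \<Rightarrow> real \<Rightarrow> real" where
  "\<xi> p \<delta> = (THE x. x > 0 \<and> F p \<delta> x = latent p * sqrt pi / (D p * c\<^sub>1 p) * G p \<delta> x)"

definition \<mu> :: "params \<Rightarrow> real \<Rightarrow> real" where
  "\<mu> p \<delta> = sqrt (\<alpha>\<^sub>1\<^sub>2 p) * W p \<delta> (\<xi> p \<delta>)"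

text \<open>The temperatures are prescribed for all $x, t > 0$ by the error-function formulas, not only on
  the physical regions $0 < x < s(t)$ and $x > r(t)$, so that solutions with different free
  boundaries can be compared at every point. The first predicate is the solution with heat
  transfer coefficient \<open>h\<close>, the second the one with \<open>\<theta>\<^sub>1 = -D\<close> at $x = 0$.\<close>

definition similarity_solution_P ::
  "params \<Rightarrow> real \<Rightarrow> (real \<Rightarrow> real \<Rightarrow> real) \<Rightarrow> (real \<Rightarrow> real \<Rightarrow> real)
    \<Rightarrow> (real \<Rightarrow> real) \<Rightarrow> (real \<Rightarrow> real) \<Rightarrow> bool" where
  "similarity_solution_P p h \<theta>\<^sub>1 \<theta>\<^sub>2 s r \<longleftrightarrow>
     (let \<xi>\<^sub>h = \<xi> p (conv_term p h); \<mu>\<^sub>h = \<mu> p (conv_term p h) in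
       (\<forall>x>0. \<forall>t>0. \<theta>\<^sub>1 x t =
          - (D p * erf \<xi>\<^sub>h / (erf \<xi>\<^sub>h + k\<^sub>1 p / (h * sqrt (pi * \<alpha>\<^sub>1 p))))
            * (1 - erf (x / (2 * sqrt (\<alpha>\<^sub>1 p * t))) / erf \<xi>\<^sub>h)) \<and>
       (\<forall>x>0. \<forall>t>0. \<theta>\<^sub>2 x t =
          \<theta>\<^sub>0 p * erf \<mu>\<^sub>h / erfc \<mu>\<^sub>h * (erf (x / (2 * sqrt (\<alpha>\<^sub>2 p * t))) / erf \<mu>\<^sub>h - 1)) \<and>
       (\<forall>t\<ge>0. s t = 2 * \<xi>\<^sub>h * sqrt (\<alpha>\<^sub>1 p * t)) \<and>
       (\<forall>t\<ge>0. r t = 2 * \<mu>\<^sub>h * sqrt (\<alpha>\<^sub>2 p * t)))"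

definition similarity_solution_P_inf ::
  "params \<Rightarrow> (real \<Rightarrow> real \<Rightarrow> real) \<Rightarrow> (real \<Rightarrow> real \<Rightarrow> real)
    \<Rightarrow> (real \<Rightarrow> real) \<Rightarrow> (real \<Rightarrow> real) \<Rightarrow> bool" where
  "similarity_solution_P_inf p \<theta>\<^sub>1 \<theta>\<^sub>2 s r \<longleftrightarrow>
     (let \<xi>\<^sub>i = \<xi> p 0; \<mu>\<^sub>i = \<mu> p 0 in
       (\<forall>x>0. \<forall>t>0. \<theta>\<^sub>1 x t =
          - D p * (1 - erf (x / (2 * sqrt (\<alpha>\<^sub>1 p * t))) / erf \<xi>\<^sub>i)) \<and>
       (\<forall>x>0. \<forall>t>0. \<theta>\<^sub>2 x t =
          \<theta>\<^sub>0 p * erf \<mu>\<^sub>i / erfc \<mu>\<^sub>i * (erf (x / (2 * sqrt (\<alpha>\<^sub>2 p * t))) / erf \<mu>\<^sub>i - 1)) \<and>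
       (\<forall>t\<ge>0. s t = 2 * \<xi>\<^sub>i * sqrt (\<alpha>\<^sub>1 p * t)) \<and>
       (\<forall>t\<ge>0. r t = 2 * \<mu>\<^sub>i * sqrt (\<alpha>\<^sub>2 p * t)))"

end

theory Submission
  imports Defs "HOL-Probability.Distributions"
begin

text \<open>
  Both problems are governed by the same equation \<open>F(x) = const \<cdot> G(x)\<close>, with \<open>\<delta> = conv_term p h\<close>
  in the convective case and \<open>\<delta> = 0\<close> in the limit. Since \<open>exp (-y\<^sup>2) / erfc y\<close> is nondecreasing,
  the difference of the two sides is decreasing in \<open>x\<close>, at a rate bounded away from 0 because
  of the summand \<open>x\<close> of \<open>G\<close>; and it is Lipschitz in \<open>\<delta>\<close>, uniformly for \<open>x\<close> near \<open>\<xi> p 0\<close>. So for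
  small \<open>\<delta>\<close> there is exactly one zero and it lies within \<open>O(\<delta>) = O(1/h)\<close> of \<open>\<xi> p 0\<close>. All
  components of the solution are differentiable functions of \<open>\<xi>\<close> and \<open>\<delta>\<close>.
\<close>

section \<open>The error function and its complement\<close>

lemma continuous_on_UNIV_at_right:
  fixes f :: "real \<Rightarrow> real"
  assumes "continuous_on UNIV f"
  shows "(f \<longlongrightarrow> f a) (at_right a)"
  using assms by (auto simp: continuous_on_def intro: tendsto_mono[OF at_le[OF subset_UNIV]])

lemma DERIV_erf [derivative_intros]:
  assumes "(f has_real_derivative f') (at x within S)"
  shows "((\<lambda>x. erf (f x)) has_real_derivative 2 / sqrt pi * exp (- (f x)\<^sup>2) * f') (at x within S)"
proof -
  have "(erf has_real_derivative 2 / sqrt pi * exp (- y\<^sup>2)) (at y)" for y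
  proof -
    \<comment> \<open>This interval has both 0 and \<open>y\<close> in its interior, whatever the
      sign of \<open>y\<close>, so the derivative within it is two-sided.\<close>
    let ?a = "- \<bar>y\<bar> - 1" and ?b = "\<bar>y\<bar> + 1"
    have "((\<lambda>u. LBINT v=ereal 0..u. exp (- v\<^sup>2)) has_vector_derivative exp (- y\<^sup>2)) (at y within {?a..?b})"
      by (rule interval_integral_FTC2) (auto intro!: continuous_intros)
    moreover have "at y within {?a..?b} = at y"
      by (rule at_within_interior) auto
    ultimately have "((\<lambda>u. LBINT v=ereal 0..u. exp (- v\<^sup>2)) has_real_derivative exp (- y\<^sup>2)) (at y)"
      by (simp add: has_real_derivative_iff_has_vector_derivative)
    from DERIV_cmult[OF this, of "2 / sqrt pi"] show ?thesis
      by (simp add: erf_def[abs_def] zero_ereal_def)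
  qed
  from DERIV_chain2[OF this assms] show ?thesis by simp
qed

lemma continuous_on_erf [continuous_intros]:
  assumes "continuous_on S f"
  shows "continuous_on S (\<lambda>x. erf (f x))"
proof -
  have "continuous_on UNIV erf"
    by (rule DERIV_continuous_on[where D = "\<lambda>x. 2 / sqrt pi * exp (- x\<^sup>2)"])
      (auto intro!: derivative_eq_intros)
  from continuous_on_compose2[OF this assms] show ?thesis by auto
qed

lemma erf_0 [simp]: "erf 0 = 0"
  by (simp add: erf_def zero_ereal_def[symmetric])

lemma strict_mono_erf: "strict_mono erf"
  by (rule strict_monoI, rule DERIV_pos_imp_increasing)
    (auto intro!: derivative_eq_intros exI)

lemma erf_pos_iff [simp]: "0 < erf x \<longleftrightarrow> 0 < x"
  using strict_mono_less[OF strict_mono_erf, of 0 x] by simp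

lemma erf_le_iff [simp]: "erf x \<le> erf y \<longleftrightarrow> x \<le> y"
  by (rule strict_mono_less_eq[OF strict_mono_erf])

lemma erf_nonneg_iff [simp]: "0 \<le> erf x \<longleftrightarrow> 0 \<le> x"
  using erf_le_iff[of 0 x] by simp

text \<open>The half-line Gaussian integral \<open>gaussian_moment_0\<close> is the limit of its
  truncations at \<open>y\<close>, and for nonnegative \<open>y\<close> these are the integrals in
  \<open>erf_def\<close>.\<close>

lemma tendsto_erf_at_top: "(erf \<longlongrightarrow> 1) at_top"
proof -
  let ?g = "\<lambda>x::real. indicator {0..} x *\<^sub>R exp (- x\<^sup>2)"
  have "((\<lambda>y. \<integral>x. indicator {..y} x *\<^sub>R ?g x \<partial>lborel) \<longlongrightarrow> (\<integral>x. ?g x \<partial>lborel)) at_top"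
    using gaussian_moment_0 by (intro tendsto_integral_at_top) (auto dest: has_bochner_integral_iff[THEN iffD1])
  also have "(\<integral>x. ?g x \<partial>lborel) = sqrt pi / 2"
    using gaussian_moment_0 by (rule has_bochner_integral_integral_eq)
  finally have "((\<lambda>y. 2 / sqrt pi * (\<integral>x. indicator {..y} x *\<^sub>R ?g x \<partial>lborel))
      \<longlongrightarrow> 2 / sqrt pi * (sqrt pi / 2)) at_top"
    by (intro tendsto_intros)
  moreover have "eventually (\<lambda>y. 2 / sqrt pi * (\<integral>x. indicator {..y} x *\<^sub>R ?g x \<partial>lborel) = erf y) at_top"
    using eventually_ge_at_top[of 0]
  proof eventually_elim
    case (elim y)
    have "(LBINT v=ereal 0..ereal y. exp (- v\<^sup>2)) = (LBINT v:{0..y}. exp (- v\<^sup>2))"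
      using elim by (rule interval_integral_Icc)
    also have "\<dots> = (\<integral>x. indicator {..y} x *\<^sub>R ?g x \<partial>lborel)"
      unfolding set_lebesgue_integral_def
      by (rule Bochner_Integration.integral_cong) (auto simp: indicator_def)
    finally show ?case by (simp add: erf_def zero_ereal_def)
  qed
  ultimately show ?thesis by (auto elim: Lim_transform_eventually)
qed

lemma erf_less_1: "erf x < 1"
proof -
  have "erf x < erf (x + 1)"
    \<comment> \<open>The limit alone gives only a weak bound; passing to \<open>x + 1\<close> makes
      it strict.\<close>
    using strict_mono_erf by (auto simp: strict_mono_def)
  also have "erf (x + 1) \<le> 1"
    using tendsto_erf_at_top eventually_ge_at_top[of "x + 1"]
    by (intro tendsto_lowerbound) (auto elim: eventually_mono)
  finally show ?thesis .
qed

lemma DERIV_erfc [derivative_intros]: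
  assumes "(f has_real_derivative f') (at x within S)"
  shows "((\<lambda>x. erfc (f x)) has_real_derivative - (2 / sqrt pi * exp (- (f x)\<^sup>2) * f')) (at x within S)"
  unfolding erfc_def by (auto intro!: derivative_eq_intros assms)

lemma continuous_on_erfc [continuous_intros]:
  "continuous_on S f \<Longrightarrow> continuous_on S (\<lambda>x. erfc (f x))"
  unfolding erfc_def by (intro continuous_intros)

lemma erfc_pos: "0 < erfc x"
  using erf_less_1[of x] by (simp add: erfc_def)

lemma erfc_le_iff [simp]: "erfc x \<le> erfc y \<longleftrightarrow> y \<le> x"
  by (simp add: erfc_def)

text \<open>After division by \<open>x\<close>, the difference of the two sides tends to 0 at infinity and is decreasing.\<close>

lemma erfc_upper_bound:
  assumes "0 < x"
  shows "sqrt pi * x * erfc x \<le> exp (- x\<^sup>2)"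
proof -
  let ?\<phi> = "\<lambda>y. exp (- y\<^sup>2) / y - sqrt pi * erfc y"
  have "((\<lambda>y::real. exp (- y\<^sup>2) * inverse y) \<longlongrightarrow> 0 * 0) at_top"
    by (intro tendsto_mult filterlim_compose[OF exp_at_bot] tendsto_inverse_0_at_top filterlim_ident
        filterlim_uminus_at_top[THEN iffD1] filterlim_pow_at_top) auto
  moreover have "((\<lambda>y. sqrt pi * erfc y) \<longlongrightarrow> sqrt pi * (1 - 1)) at_top"
    unfolding erfc_def[abs_def] by (intro tendsto_intros tendsto_erf_at_top)
  ultimately have "(?\<phi> \<longlongrightarrow> 0 * 0 - sqrt pi * (1 - 1)) at_top"
    unfolding divide_inverse by (rule tendsto_diff)
  then have lim: "(?\<phi> \<longlongrightarrow> 0) at_top" by simp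
  have "\<exists>d. (?\<phi> has_real_derivative d) (at y) \<and> d < 0" if "x \<le> y" for y
  proof (intro exI conjI)
    have y: "0 < y" using assms that by simp
    \<comment> \<open>The contributions \<open>2 * exp (- y\<^sup>2)\<close> of the two terms
      cancel.\<close>
    show "(?\<phi> has_real_derivative - (exp (- y\<^sup>2) / y\<^sup>2)) (at y)"
      using y by (auto intro!: derivative_eq_intros simp: field_simps power2_eq_square)
    show "- (exp (- y\<^sup>2) / y\<^sup>2) < 0" using y by simp
  qed
  from DERIV_neg_imp_decreasing_at_top[OF this lim] have "0 < ?\<phi> x" by simp
  then show ?thesis using assms by (simp add: field_simps)
qed

section \<open>Monotonicity and Lipschitz bound for the quotient of the Gaussian and
  \<open>erfc\<close>\<close>

text \<open>Up to scaling of argument and value, this is the hazard rate of the normal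
  distribution.\<close>

definition erfc_ratio :: "real \<Rightarrow> real" where
  "erfc_ratio y = exp (- y\<^sup>2) / erfc y"

lemma DERIV_erfc_ratio:
  "(erfc_ratio has_real_derivative
     2 * exp (- y\<^sup>2) * (exp (- y\<^sup>2) / sqrt pi - y * erfc y) / (erfc y)\<^sup>2) (at y)"
  unfolding erfc_ratio_def[abs_def] using erfc_pos[of y]
  by (auto intro!: derivative_eq_intros simp: field_simps power2_eq_square)

lemma continuous_on_erfc_ratio [continuous_intros]:
  "continuous_on S f \<Longrightarrow> continuous_on S (\<lambda>x. erfc_ratio (f x))"
  unfolding erfc_ratio_def using erfc_pos by (intro continuous_intros) (auto simp: less_imp_neq[symmetric])

text \<open>The sign of the derivative is that of
  \<open>exp (- t\<^sup>2) / sqrt pi - t * erfc t\<close>, which \<open>erfc_upper_bound\<close>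
  controls for positive \<open>t\<close>; at 0 it is clear.\<close>

lemma erfc_ratio_mono:
  assumes "0 \<le> x" "x \<le> y"
  shows "erfc_ratio x \<le> erfc_ratio y"
proof (rule DERIV_nonneg_imp_nondecreasing[OF assms(2)])
  fix t assume t: "x \<le> t" "t \<le> y"
  have "t * erfc t \<le> exp (- t\<^sup>2) / sqrt pi"
  proof (cases "t = 0")
    case False
    with t assms erfc_upper_bound[of t] show ?thesis by (simp add: field_simps)
  qed simp
  then have "0 \<le> 2 * exp (- t\<^sup>2) * (exp (- t\<^sup>2) / sqrt pi - t * erfc t) / (erfc t)\<^sup>2"
    by simp
  with DERIV_erfc_ratio show "\<exists>d. (erfc_ratio has_real_derivative d) (at t) \<and> 0 \<le> d"
    by blast
qed

text \<open>For nonnegative \<open>t\<close>, dropping \<open>t * erfc t\<close> and bounding the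
  exponentials by 1 leaves a bound on the derivative that is worst where \<open>erfc\<close> is
  smallest, at \<open>M\<close>.\<close>

lemma erfc_ratio_lipschitz:
  assumes "0 \<le> x" "x \<le> y" "y \<le> M"
  shows "erfc_ratio y - erfc_ratio x \<le> 2 / (sqrt pi * (erfc M)\<^sup>2) * (y - x)"
proof -
  define L where "L = 2 / (sqrt pi * (erfc M)\<^sup>2)"
  have "L * x - erfc_ratio x \<le> L * y - erfc_ratio y"
  proof (rule DERIV_nonneg_imp_nondecreasing[OF assms(2)])
    fix t assume t: "x \<le> t" "t \<le> y"
    let ?d = "2 * exp (- t\<^sup>2) * (exp (- t\<^sup>2) / sqrt pi - t * erfc t) / (erfc t)\<^sup>2"
    have "((\<lambda>t. L * t - erfc_ratio t) has_real_derivative L - ?d) (at t)"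
      by (auto intro!: derivative_eq_intros DERIV_erfc_ratio)
    moreover have "?d \<le> 2 * 1 * (1 / sqrt pi) / (erfc M)\<^sup>2"
    proof (rule frac_le)
      have "exp (- t\<^sup>2) / sqrt pi - t * erfc t \<le> 1 / sqrt pi"
        using t assms erfc_pos[of t]
        by (smt (verit) divide_right_mono exp_le_one_iff mult_nonneg_nonneg real_sqrt_gt_zero pi_gt_zero zero_le_power2)
      then show "2 * exp (- t\<^sup>2) * (exp (- t\<^sup>2) / sqrt pi - t * erfc t) \<le> 2 * 1 * (1 / sqrt pi)"
        by (smt (verit) exp_gt_zero exp_le_one_iff mult_left_mono mult_right_mono zero_le_power2
            divide_nonneg_nonneg real_sqrt_ge_zero pi_ge_zero)
      show "(erfc M)\<^sup>2 \<le> (erfc t)\<^sup>2"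
        using t assms erfc_pos[of M] by (intro power_mono) auto
    qed (use erfc_pos[of M] in auto)
    ultimately show "\<exists>d. ((\<lambda>t. L * t - erfc_ratio t) has_real_derivative d) (at t) \<and> 0 \<le> d"
      by (intro exI[of _ "L - ?d"]) (simp add: L_def)
  qed
  then show ?thesis by (simp add: L_def[symmetric] right_diff_distrib)
qed

section \<open>Calculus of O-estimates for the distance to a limit\<close>

text \<open>Through this the convergence claims follow from the rates.\<close>

lemma bigo_imp_tendsto:
  fixes f g :: "_ \<Rightarrow> real"
  assumes "(g \<longlongrightarrow> 0) net" "(\<lambda>h. f h - a) \<in> O[net](g)"
  shows "(f \<longlongrightarrow> a) net"
proof -
  have "((\<lambda>h. f h - a) \<longlongrightarrow> 0) net"
    using assms(2) by (elim landau_o.bigE) (rule tendsto_0_le[OF assms(1)], simp add: mult.commute)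
  then show ?thesis by (simp add: LIM_zero_iff)
qed

text \<open>Differentiability at the single point \<open>a\<close> bounds
  \<open>\<bar>u y - u a\<bar>\<close> by a multiple of \<open>\<bar>y - a\<bar>\<close> near
  \<open>a\<close>, and \<open>f h\<close> is eventually that near.\<close>

lemma bigo_diff_compose:
  fixes f g :: "_ \<Rightarrow> real"
  assumes u: "(u has_real_derivative d) (at a)"
    and g: "(g \<longlongrightarrow> 0) net" and f: "(\<lambda>h. f h - a) \<in> O[net](g)"
  shows "(\<lambda>h. u (f h) - u a) \<in> O[net](g)"
proof -
  have "((\<lambda>y. \<bar>(u y - u a) / (y - a)\<bar>) \<longlongrightarrow> \<bar>d\<bar>) (at a)"
    using u by (intro tendsto_rabs) (simp add: has_field_derivative_iff)
  then have "eventually (\<lambda>y. \<bar>(u y - u a) / (y - a)\<bar> < \<bar>d\<bar> + 1) (at a)"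
    by (rule order_tendstoD) simp
  then have "eventually (\<lambda>y. \<bar>u y - u a\<bar> \<le> (\<bar>d\<bar> + 1) * \<bar>y - a\<bar>) (at a)"
    unfolding eventually_at_filter by eventually_elim (auto simp: field_simps)
  \<comment> \<open>The point \<open>a\<close> itself must be included, since \<open>f h\<close> may
    equal \<open>a\<close>; there both sides vanish.\<close>
  then have "eventually (\<lambda>y. \<bar>u y - u a\<bar> \<le> (\<bar>d\<bar> + 1) * \<bar>y - a\<bar>) (nhds a)"
    unfolding eventually_at_filter by eventually_elim auto
  from eventually_compose_filterlim[OF this bigo_imp_tendsto[OF g f]]
  have "(\<lambda>h. u (f h) - u a) \<in> O[net](\<lambda>h. f h - a)"
    by (intro bigoI[where c = "\<bar>d\<bar> + 1"]) simp
  with f show ?thesis by (rule landau_o.big_trans[rotated])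
qed

lemma bigo_diff_add:
  fixes f1 f2 g :: "_ \<Rightarrow> real"
  assumes "(\<lambda>h. f1 h - a1) \<in> O[net](g)" "(\<lambda>h. f2 h - a2) \<in> O[net](g)"
  shows "(\<lambda>h. (f1 h + f2 h) - (a1 + a2)) \<in> O[net](g)"
  using sum_in_bigo(1)[OF assms] by (simp add: algebra_simps)

lemma bigo_diff_cmult:
  fixes f g :: "_ \<Rightarrow> real"
  assumes "(\<lambda>h. f h - a) \<in> O[net](g)"
  shows "(\<lambda>h. c * f h - c * a) \<in> O[net](g)"
  using landau_o.big.cmult_in_iff'[of c] assms
  by (cases "c = 0") (auto simp: right_diff_distrib[symmetric])

text \<open>Split the difference as \<open>f1 h * (f2 h - a2) + a2 * (f1 h - a1)\<close>, where
  \<open>f1\<close> is bounded because it converges.\<close>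

lemma bigo_diff_mult:
  fixes f1 f2 g :: "_ \<Rightarrow> real"
  assumes g: "(g \<longlongrightarrow> 0) net"
    and f: "(\<lambda>h. f1 h - a1) \<in> O[net](g)" "(\<lambda>h. f2 h - a2) \<in> O[net](g)"
  shows "(\<lambda>h. f1 h * f2 h - a1 * a2) \<in> O[net](g)"
proof -
  have "(f1 \<longlongrightarrow> a1) net" by (rule bigo_imp_tendsto[OF g f(1)])
  then have "f1 \<in> O[net](\<lambda>_. 1)" by (intro bigoI_tendsto[where c = a1]) auto
  from landau_o.big.mult[OF this f(2)] have "(\<lambda>h. f1 h * (f2 h - a2)) \<in> O[net](g)" by simp
  moreover have "(\<lambda>h. a2 * f1 h - a2 * a1) \<in> O[net](g)"
    by (rule bigo_diff_cmult[OF f(1)])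
  ultimately have "(\<lambda>h. f1 h * (f2 h - a2) + (a2 * f1 h - a2 * a1)) \<in> O[net](g)"
    by (rule sum_in_bigo(1))
  then show ?thesis by (simp add: algebra_simps)
qed

lemma bigo_diff_divide:
  fixes f1 f2 g :: "_ \<Rightarrow> real"
  assumes g: "(g \<longlongrightarrow> 0) net"
    and f: "(\<lambda>h. f1 h - a1) \<in> O[net](g)" "(\<lambda>h. f2 h - a2) \<in> O[net](g)" and "a2 \<noteq> 0"
  shows "(\<lambda>h. f1 h / f2 h - a1 / a2) \<in> O[net](g)"
  unfolding divide_inverse
  by (rule bigo_diff_mult[OF g f(1) bigo_diff_compose[OF DERIV_inverse[OF \<open>a2 \<noteq> 0\<close>] g f(2)]])


section \<open>Perturbation of the zero of a decreasing function\<close>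

text \<open>Between \<open>z\<close> and either of \<open>z / 2\<close> and \<open>2 * z\<close>,
  \<open>H 0\<close> changes by at least \<open>c * (z / 2)\<close>, more than the perturbation
  \<open>C * \<delta>\<close>. Hence \<open>H \<delta>\<close> still changes sign on that interval,
  which stays away from 0.\<close>

lemma root_perturbation:
  fixes H :: "real \<Rightarrow> real \<Rightarrow> real"
  assumes "0 < c" "0 < z" "H 0 z = 0"
    and decr: "\<And>\<delta> x y. 0 \<le> \<delta> \<Longrightarrow> 0 < x \<Longrightarrow> x \<le> y \<Longrightarrow> c * (y - x) \<le> H \<delta> x - H \<delta> y"
    and cont: "\<And>\<delta> a b. 0 \<le> \<delta> \<Longrightarrow> 0 < a \<Longrightarrow> continuous_on {a..b} (H \<delta>)"
    and lip: "\<And>\<delta> x. 0 \<le> \<delta> \<Longrightarrow> \<delta> \<le> 1 \<Longrightarrow> z / 2 \<le> x \<Longrightarrow> x \<le> 2 * z \<Longrightarrow> \<bar>H \<delta> x - H 0 x\<bar> \<le> C * \<delta>"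
    and \<delta>: "0 \<le> \<delta>" "\<delta> \<le> 1" "C * \<delta> < c * (z / 2)"
  shows "\<exists>x>0. H \<delta> x = 0 \<and> \<bar>x - z\<bar> \<le> C / c * \<delta>"
proof -
  have "H \<delta> (2 * z) \<le> 0"
    using lip[of \<delta> "2 * z"] decr[of 0 z "2 * z"] assms(1-3) \<delta> by (simp add: algebra_simps)
  moreover have "0 \<le> H \<delta> (z / 2)"
    using lip[of \<delta> "z / 2"] decr[of 0 "z / 2" z] assms(1-3) \<delta> by (simp add: algebra_simps)
  ultimately obtain x where x: "z / 2 \<le> x" "x \<le> 2 * z" "H \<delta> x = 0"
    using IVT2'[of "H \<delta>" "2 * z" 0 "z / 2"] cont[of \<delta> "z / 2" "2 * z"] \<open>0 < z\<close> \<delta> by auto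
  \<comment> \<open>At the perturbed root, \<open>\<bar>H 0 x\<bar>\<close> is just the size of the
    perturbation, while the decrease of \<open>H 0\<close> converts it into a distance.\<close>
  have "c * \<bar>x - z\<bar> \<le> \<bar>H 0 x - H 0 z\<bar>"
    using decr[of 0 x z] decr[of 0 z x] x assms(1,2) by (cases "x \<le> z") auto
  also have "\<dots> \<le> C * \<delta>"
    using lip[of \<delta> x] x \<delta> \<open>H 0 z = 0\<close> by simp
  finally have "\<bar>x - z\<bar> \<le> C / c * \<delta>" using \<open>0 < c\<close> by (simp add: field_simps)
  with x \<open>0 < z\<close> show ?thesis by (intro exI[of _ x]) auto
qed

section \<open>The equation for \<open>\<xi>\<close>: monotonicity, uniqueness and existence\<close>

definition defect :: "params \<Rightarrow> real \<Rightarrow> real \<Rightarrow> real" where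
  "defect p \<delta> x = F p \<delta> x - latent p * sqrt pi / (D p * c\<^sub>1 p) * G p \<delta> x"

lemma \<xi>_eq_defect: "\<xi> p \<delta> = (THE x. x > 0 \<and> defect p \<delta> x = 0)"
  by (simp add: \<xi>_def defect_def)

lemma admissible_pos:
  assumes "admissible p"
  shows "0 < \<alpha>\<^sub>1 p" "0 < \<alpha>\<^sub>2 p" "0 < \<alpha>\<^sub>1\<^sub>2 p" "0 < latent p * sqrt pi / (D p * c\<^sub>1 p)"
    "0 < \<gamma> p * sqrt pi / (2 * D p)" "0 < (1 - \<epsilon> p) * \<gamma> p * sqrt pi / (2 * D p)"
    "0 < \<theta>\<^sub>0 p * sqrt (k\<^sub>2 p * c\<^sub>2 p) / (D p * sqrt (k\<^sub>1 p * c\<^sub>1 p))"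
  using assms by (auto simp: admissible_def \<alpha>\<^sub>1_def \<alpha>\<^sub>2_def \<alpha>\<^sub>1\<^sub>2_def)

text \<open>Positivity of \<open>\<alpha>\<^sub>1\<^sub>2 p\<close> lets the square root be squared
  back, so that exponential and \<open>erfc\<close> share one argument.\<close>

lemma F_eq_erfc_ratio:
  assumes "admissible p"
  shows "F p \<delta> x = exp (- (x\<^sup>2)) / (erf x + \<delta>)
     - \<theta>\<^sub>0 p * sqrt (k\<^sub>2 p * c\<^sub>2 p) / (D p * sqrt (k\<^sub>1 p * c\<^sub>1 p))
       * erfc_ratio (sqrt (\<alpha>\<^sub>1\<^sub>2 p) * W p \<delta> x)"
  using admissible_pos(3)[OF assms] by (simp add: F_def erfc_ratio_def power_mult_distrib)

text \<open>This product is the nonlinear part of both \<open>W\<close> and \<open>G\<close>; on the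
  nonnegative half-line both factors are nonnegative and nondecreasing.\<close>

lemma exp_erf_mono:
  assumes "0 \<le> \<delta>" "0 \<le> x" "x \<le> y"
  shows "exp (x\<^sup>2) * (erf x + \<delta>) \<le> exp (y\<^sup>2) * (erf y + \<delta>)"
  using assms by (intro mult_mono add_right_mono) (auto intro: power_mono)

lemma W_mono:
  assumes "admissible p" "0 \<le> \<delta>" "0 \<le> x" "x \<le> y"
  shows "W p \<delta> x \<le> W p \<delta> y"
  using mult_left_mono[OF exp_erf_mono[OF assms(2-4)] less_imp_le[OF admissible_pos(5)[OF assms(1)]]] assms(4)
  by (simp add: W_def mult.assoc)

lemma W_pos:
  assumes "admissible p" "0 \<le> \<delta>" "0 < x"
  shows "0 < W p \<delta> x"
  unfolding W_def using assms admissible_pos(5)[OF assms(1)]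
  by (intro add_pos_nonneg mult_nonneg_nonneg add_nonneg_nonneg) (auto simp: less_imp_le)

lemma G_increasing:
  assumes "admissible p" "0 \<le> \<delta>" "0 \<le> x" "x \<le> y"
  shows "y - x \<le> G p \<delta> y - G p \<delta> x"
  using mult_left_mono[OF exp_erf_mono[OF assms(2-4)] less_imp_le[OF admissible_pos(6)[OF assms(1)]]]
  by (simp add: G_def mult.assoc)

text \<open>In the first quotient the numerator falls and the denominator grows; the second term is
  subtracted and composes \<open>erfc_ratio\<close> with the nondecreasing \<open>W\<close>.\<close>

lemma F_decreasing:
  assumes "admissible p" "0 \<le> \<delta>" "0 < x" "x \<le> y"
  shows "F p \<delta> y \<le> F p \<delta> x"
proof -
  have "exp (- (y\<^sup>2)) / (erf y + \<delta>) \<le> exp (- (x\<^sup>2)) / (erf x + \<delta>)"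
    using assms by (intro frac_le) (auto intro: power_mono add_pos_nonneg)
  moreover have "erfc_ratio (sqrt (\<alpha>\<^sub>1\<^sub>2 p) * W p \<delta> x) \<le> erfc_ratio (sqrt (\<alpha>\<^sub>1\<^sub>2 p) * W p \<delta> y)"
    using assms admissible_pos(3)[OF assms(1)] W_pos[of p \<delta> x] W_mono[of p \<delta> x y]
    by (intro erfc_ratio_mono mult_nonneg_nonneg mult_left_mono) auto
  ultimately show ?thesis
    unfolding F_eq_erfc_ratio[OF assms(1)]
    by (intro diff_mono mult_left_mono less_imp_le[OF admissible_pos(7)[OF assms(1)]])
qed

text \<open>The rate comes from \<open>G\<close> alone and is the same for all nonnegative \<delta>,
  as \<open>root_perturbation\<close> requires.\<close>

lemma defect_decreasing:
  assumes "admissible p" "0 \<le> \<delta>" "0 < x" "x \<le> y"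
  shows "latent p * sqrt pi / (D p * c\<^sub>1 p) * (y - x) \<le> defect p \<delta> x - defect p \<delta> y"
  using mult_left_mono[OF G_increasing[of p \<delta> x y], of "latent p * sqrt pi / (D p * c\<^sub>1 p)"]
    F_decreasing[OF assms] admissible_pos(4)[OF assms(1)] assms
  by (simp add: defect_def right_diff_distrib)

lemma defect_root_unique:
  assumes "admissible p" "0 \<le> \<delta>" "0 < x" "0 < y" "defect p \<delta> x = 0" "defect p \<delta> y = 0"
  shows "x = y"
  using defect_decreasing[of p \<delta> x y] defect_decreasing[of p \<delta> y x] admissible_pos(4)[OF assms(1)] assms
  by (smt (verit) mult_pos_pos)

text \<open>This evaluates the definite description: by uniqueness, any positive zero that is
  exhibited must be the chosen one.\<close>

lemma \<xi>_eqI: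
  assumes "admissible p" "0 \<le> \<delta>" "0 < x" "defect p \<delta> x = 0"
  shows "\<xi> p \<delta> = x"
  unfolding \<xi>_eq_defect using assms defect_root_unique[OF assms(1,2)] by blast

lemma continuous_on_W [continuous_intros]:
  "continuous_on S f \<Longrightarrow> continuous_on S (\<lambda>x. W p \<delta> (f x))"
  unfolding W_def divide_inverse by (intro continuous_intros)

lemma continuous_on_G [continuous_intros]:
  "continuous_on S f \<Longrightarrow> continuous_on S (\<lambda>x. G p \<delta> (f x))"
  unfolding G_def divide_inverse by (intro continuous_intros)

lemma continuous_on_defect:
  assumes "admissible p" "0 \<le> \<delta>" "0 < a"
  shows "continuous_on {a..b} (defect p \<delta>)"
proof -
  have "erf x + \<delta> \<noteq> 0" if "a \<le> x" for x
    using assms that erf_pos_iff[of x] by linarith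
  then show ?thesis
    unfolding defect_def F_eq_erfc_ratio[OF assms(1)]
    by (intro continuous_intros) auto
qed

text \<open>Near 0 the term \<open>exp (- x\<^sup>2) / erf x\<close> blows up while the others stay
  bounded, so the defect starts nonnegative; its steady decrease then forces a sign change.\<close>

lemma defect_0_root:
  assumes "admissible p"
  shows "\<exists>x>0. defect p 0 x = 0"
proof -
  define c where "c = latent p * sqrt pi / (D p * c\<^sub>1 p)"
  define q where "q = \<theta>\<^sub>0 p * sqrt (k\<^sub>2 p * c\<^sub>2 p) / (D p * sqrt (k\<^sub>1 p * c\<^sub>1 p))"
  have c: "0 < c" unfolding c_def by (rule admissible_pos[OF assms])
  let ?R = "\<lambda>x. - q * erfc_ratio (sqrt (\<alpha>\<^sub>1\<^sub>2 p) * W p 0 x) - c * G p 0 x"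
  have R: "defect p 0 x = ?R x + exp (- x\<^sup>2) / erf x" for x
    by (simp add: defect_def F_eq_erfc_ratio[OF assms] q_def c_def)
  have "continuous_on UNIV ?R" by (intro continuous_intros)
  then have "(?R \<longlongrightarrow> ?R 0) (at_right 0)"
    by (rule continuous_on_UNIV_at_right)
  moreover have "LIM x at_right 0. exp (- x\<^sup>2) / erf x :> at_top"
  proof -
    have "((\<lambda>x::real. exp (- x\<^sup>2)) \<longlongrightarrow> exp (- 0\<^sup>2)) (at_right 0)"
      by (intro tendsto_intros)
    moreover have "LIM x at_right 0. erf x :> at_right 0"
      unfolding filterlim_at
    proof
      show "\<forall>\<^sub>F x in at_right 0. erf x \<in> {0<..} \<and> erf x \<noteq> 0"
        using eventually_at_right_less[of 0] by eventually_elim (simp add: less_imp_neq[symmetric])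
      have "continuous_on UNIV erf"
        using continuous_on_erf[OF continuous_on_id] by simp
      then have "(erf \<longlongrightarrow> erf 0) (at_right 0)"
        by (rule continuous_on_UNIV_at_right)
      then show "(erf \<longlongrightarrow> 0) (at_right 0)" by simp
    qed
    ultimately show ?thesis
      unfolding divide_inverse
      by (intro filterlim_tendsto_pos_mult_at_top[where c = 1] filterlim_compose[OF filterlim_inverse_at_top_right]) auto
  qed
  ultimately have "LIM x at_right 0. defect p 0 x :> at_top"
    unfolding R by (rule filterlim_tendsto_add_at_top)
  then have "eventually (\<lambda>x. 0 \<le> defect p 0 x) (at_right 0)"
    by (simp add: filterlim_at_top)
  then obtain a where a: "0 < a" "0 \<le> defect p 0 a"
    using eventually_happens[OF eventually_conj[OF _ eventually_at_right_less]] trivial_limit_at_right_real by blast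
  \<comment> \<open>Decreasing at rate at least \<open>c\<close>, the defect loses all of its value
    at \<open>a\<close> over this distance.\<close>
  define b where "b = a + defect p 0 a / c"
  have "a \<le> b" using a c by (simp add: b_def)
  then have "defect p 0 b \<le> 0"
    using defect_decreasing[OF assms order_refl a(1) \<open>a \<le> b\<close>] c by (simp add: b_def c_def[symmetric])
  from IVT2'[OF this a(2) \<open>a \<le> b\<close> continuous_on_defect[OF assms order_refl a(1)]] a(1)
  show ?thesis by (metis less_le_trans)
qed

lemma \<xi>_0:
  assumes "admissible p"
  shows "0 < \<xi> p 0" "defect p 0 (\<xi> p 0) = 0"
  using defect_0_root[OF assms] \<xi>_eqI[OF assms order_refl] by auto

section \<open>Lipschitz dependence of the defect on \<delta>\<close>

lemma defect_lipschitz: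
  assumes p: "admissible p" and "0 < a"
  obtains C where "\<And>\<delta> x. 0 \<le> \<delta> \<Longrightarrow> \<delta> \<le> 1 \<Longrightarrow> a \<le> x \<Longrightarrow> x \<le> b \<Longrightarrow> \<bar>defect p \<delta> x - defect p 0 x\<bar> \<le> C * \<delta>"
proof -
  define c where "c = latent p * sqrt pi / (D p * c\<^sub>1 p)"
  define q where "q = \<theta>\<^sub>0 p * sqrt (k\<^sub>2 p * c\<^sub>2 p) / (D p * sqrt (k\<^sub>1 p * c\<^sub>1 p))"
  define w where "w = \<gamma> p * sqrt pi / (2 * D p)"
  define v where "v = (1 - \<epsilon> p) * \<gamma> p * sqrt pi / (2 * D p)"
  define A where "A = sqrt (\<alpha>\<^sub>1\<^sub>2 p)"
  have pos: "0 < c" "0 < q" "0 < w" "0 < v" "0 < A"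
    using admissible_pos[OF p] by (simp_all add: c_def q_def w_def v_def A_def)
  \<comment> \<open>\<open>W p 1 b\<close> bounds every value of \<open>W\<close> that occurs, since
    \<open>W\<close> grows with \<open>x\<close> and with \<delta>; \<open>L\<close> is the
    Lipschitz constant of \<open>erfc_ratio\<close> up to the corresponding argument.\<close>
  define L where "L = 2 / (sqrt pi * (erfc (A * W p 1 b))\<^sup>2)"
  have "0 \<le> L" by (simp add: L_def)
  \<comment> \<open>The three summands bound the changes of the first quotient, of the
    \<open>erfc_ratio\<close> term and of the \<open>G\<close> term.\<close>
  define C where "C = 1 / (erf a)\<^sup>2 + q * (L * (A * (w * exp (b\<^sup>2)))) + c * (v * exp (b\<^sup>2))"
  have "\<bar>defect p \<delta> x - defect p 0 x\<bar> \<le> C * \<delta>" if \<delta>: "0 \<le> \<delta>" "\<delta> \<le> 1" and x: "a \<le> x" "x \<le> b" for \<delta> x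
  proof -
    have x0: "0 < x" using x \<open>0 < a\<close> by simp
    have exp_le: "exp (x\<^sup>2) * \<delta> \<le> exp (b\<^sup>2) * \<delta>"
      using x x0 \<delta> by (intro mult_right_mono) (auto intro: power_mono)
    have exp_ge: "0 \<le> exp (x\<^sup>2) * \<delta>" using \<delta> by simp
    \<comment> \<open>\<open>W\<close> and \<open>G\<close> are affine in \<delta>, so these
      differences are exact.\<close>
    have W: "W p \<delta> x - W p 0 x = w * (exp (x\<^sup>2) * \<delta>)"
      by (simp add: W_def w_def algebra_simps add_divide_distrib diff_divide_distrib)
    have G: "G p \<delta> x - G p 0 x = v * (exp (x\<^sup>2) * \<delta>)"
      by (simp add: G_def v_def algebra_simps add_divide_distrib diff_divide_distrib)
    have W_le: "W p 0 x \<le> W p \<delta> x"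
      using mult_nonneg_nonneg[OF less_imp_le[OF pos(3)] exp_ge] unfolding W[symmetric] by simp
    have W01: "W p \<delta> x \<le> W p 1 b"
    proof -
      have "W p \<delta> x \<le> W p \<delta> b" using W_mono[OF p \<delta>(1)] x x0 by simp
      also have "\<dots> \<le> W p 1 b" using \<delta> pos(3) unfolding W_def w_def[symmetric] by simp
      finally show ?thesis .
    qed
    have "0 \<le> exp (- x\<^sup>2) / erf x - exp (- x\<^sup>2) / (erf x + \<delta>)"
      using x0 \<delta> by (simp add: frac_le)
    moreover have "exp (- x\<^sup>2) / erf x - exp (- x\<^sup>2) / (erf x + \<delta>) \<le> 1 / (erf a)\<^sup>2 * \<delta>"
    proof -
      have e: "0 < erf a" "erf a \<le> erf x" using x \<open>0 < a\<close> by auto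
      have "exp (- x\<^sup>2) / erf x - exp (- x\<^sup>2) / (erf x + \<delta>) = exp (- x\<^sup>2) * \<delta> / (erf x * (erf x + \<delta>))"
      proof (subst diff_frac_eq)
        show "erf x \<noteq> 0" "erf x + \<delta> \<noteq> 0" using e \<delta> by linarith+
      qed (simp add: algebra_simps)
      also have "\<dots> \<le> 1 * \<delta> / (erf a * erf a)"
        using e \<delta> by (intro frac_le mult_mono mult_right_mono) (auto simp: add_increasing2)
      finally show ?thesis by (simp add: power2_eq_square)
    qed
    moreover have "0 \<le> q * (erfc_ratio (A * W p \<delta> x) - erfc_ratio (A * W p 0 x))"
      using W_le pos W_pos[OF p order_refl x0]
      by (intro mult_nonneg_nonneg) (auto intro!: erfc_ratio_mono mult_left_mono simp: less_imp_le)
    moreover have "q * (erfc_ratio (A * W p \<delta> x) - erfc_ratio (A * W p 0 x)) \<le> q * (L * (A * (w * exp (b\<^sup>2)))) * \<delta>"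
    proof -
      have "0 \<le> A * W p 0 x" "A * W p 0 x \<le> A * W p \<delta> x" "A * W p \<delta> x \<le> A * W p 1 b"
        using W_le W01 pos W_pos[OF p order_refl x0]
        by (auto intro!: mult_left_mono simp: less_imp_le)
      from erfc_ratio_lipschitz[OF this]
      have "erfc_ratio (A * W p \<delta> x) - erfc_ratio (A * W p 0 x) \<le> L * (A * (W p \<delta> x - W p 0 x))"
        by (simp add: L_def right_diff_distrib)
      also have "\<dots> \<le> L * (A * (w * (exp (b\<^sup>2) * \<delta>)))"
        unfolding W using pos \<open>0 \<le> L\<close> exp_le by (intro mult_left_mono) auto
      finally show ?thesis using pos(2) by (simp add: mult.assoc)
    qed
    moreover have "0 \<le> c * (G p \<delta> x - G p 0 x)" "c * (G p \<delta> x - G p 0 x) \<le> c * (v * exp (b\<^sup>2)) * \<delta>"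
      unfolding G using pos exp_ge exp_le by (auto simp: mult.assoc intro!: mult_left_mono)
    \<comment> \<open>All three changes are nonnegative and enter with a minus sign, so their upper
      bounds add up to a bound on the absolute value.\<close>
    moreover have "defect p \<delta> x - defect p 0 x =
        - (exp (- x\<^sup>2) / erf x - exp (- x\<^sup>2) / (erf x + \<delta>))
        - q * (erfc_ratio (A * W p \<delta> x) - erfc_ratio (A * W p 0 x)) - c * (G p \<delta> x - G p 0 x)"
      by (simp add: defect_def F_eq_erfc_ratio[OF p] q_def c_def A_def right_diff_distrib)
    ultimately show ?thesis unfolding C_def distrib_right by linarith
  qed
  then show ?thesis by (rule that)
qed

section \<open>Rates of convergence of \<open>\<xi>\<close> and \<open>\<mu>\<close>\<close>

lemma inverse_at_top_tendsto: "((\<lambda>h::real. 1 / h) \<longlongrightarrow> 0) at_top"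
  using tendsto_inverse_0_at_top[OF filterlim_ident] by (simp add: inverse_eq_divide)

lemma conv_term_bigo: "conv_term p \<in> O(\<lambda>h. 1 / h)"
  by (intro bigoI[where c = "\<bar>k\<^sub>1 p / sqrt (\<alpha>\<^sub>1 p * pi)\<bar>"]) (simp add: conv_term_def abs_mult mult.commute)

text \<open>For large \<open>h\<close>, \<open>conv_term p h\<close> is small and nonnegative, so
  \<open>root_perturbation\<close> supplies a zero near \<open>\<xi> p 0\<close>, and
  \<open>\<xi>_eqI\<close> identifies it with \<open>\<xi> p (conv_term p h)\<close>.\<close>

lemma \<xi>_conv_term_bigo:
  assumes p: "admissible p"
  shows "(\<lambda>h. \<xi> p (conv_term p h) - \<xi> p 0) \<in> O(\<lambda>h. 1 / h)"
proof -
  define c where "c = latent p * sqrt pi / (D p * c\<^sub>1 p)"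
  have c: "0 < c" unfolding c_def by (rule admissible_pos[OF p])
  note decr = defect_decreasing[OF p, folded c_def] and z = \<xi>_0[OF p]
  obtain C where C: "\<And>\<delta> x. 0 \<le> \<delta> \<Longrightarrow> \<delta> \<le> 1 \<Longrightarrow> \<xi> p 0 / 2 \<le> x \<Longrightarrow> x \<le> 2 * \<xi> p 0 \<Longrightarrow>
      \<bar>defect p \<delta> x - defect p 0 x\<bar> \<le> C * \<delta>"
    by (rule defect_lipschitz[OF p half_gt_zero[OF z(1)], of "2 * \<xi> p 0"]) blast
  have lim: "(conv_term p \<longlongrightarrow> 0) at_top"
    by (rule bigo_imp_tendsto[OF inverse_at_top_tendsto]) (use conv_term_bigo in simp)
  have "0 \<le> conv_term p h" if "0 < h" for h
    using that p admissible_pos(1)[OF p] by (simp add: conv_term_def admissible_def)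
  then have "eventually (\<lambda>h. 0 \<le> conv_term p h) at_top"
    by (intro eventually_mono[OF eventually_gt_at_top[of 0]])
  moreover have "eventually (\<lambda>h. conv_term p h < 1) at_top"
    using lim by (rule order_tendstoD) simp
  moreover have "((\<lambda>h. C * conv_term p h) \<longlongrightarrow> C * 0) at_top"
    by (intro tendsto_intros lim)
  then have "eventually (\<lambda>h. C * conv_term p h < c * (\<xi> p 0 / 2)) at_top"
    by (rule order_tendstoD) (use c z in simp)
  ultimately have "eventually (\<lambda>h. \<bar>\<xi> p (conv_term p h) - \<xi> p 0\<bar> \<le> C / c * conv_term p h) at_top"
  proof eventually_elim
    case (elim h)
    have "\<exists>x>0. defect p (conv_term p h) x = 0 \<and> \<bar>x - \<xi> p 0\<bar> \<le> C / c * conv_term p h"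
      by (rule root_perturbation[where H = "defect p", OF c z])
        (use elim C in \<open>auto intro: decr continuous_on_defect[OF p]\<close>)
    with \<xi>_eqI[OF p elim(1)] show ?case by auto
  qed
  then have "(\<lambda>h. \<xi> p (conv_term p h) - \<xi> p 0) \<in> O(conv_term p)"
    \<comment> \<open>The absolute value is taken because \<open>defect_lipschitz\<close> does not
      state a sign for \<open>C\<close>.\<close>
    by (intro bigoI[where c = "\<bar>C / c\<bar>"])
      (auto elim!: eventually_mono simp: abs_mult[symmetric] simp del: abs_divide)
  also note conv_term_bigo
  finally show ?thesis .
qed


text \<open>Here \<open>h\<close> enters through both \<open>\<xi>\<close> and \<delta>. The
  one-variable composition rule handles \<open>exp\<close> and \<open>erf\<close> of
  \<open>\<xi>\<close>; sums and products combine these with \<delta>.\<close>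

lemma \<mu>_conv_term_bigo:
  assumes p: "admissible p"
  shows "(\<lambda>h. \<mu> p (conv_term p h) - \<mu> p 0) \<in> O(\<lambda>h. 1 / h)"
proof -
  note g = inverse_at_top_tendsto and \<xi> = \<xi>_conv_term_bigo[OF p]
  have \<delta>: "(\<lambda>h. conv_term p h - 0) \<in> O(\<lambda>h. 1 / h)"
    using conv_term_bigo by simp
  have "(\<lambda>h. exp ((\<xi> p (conv_term p h))\<^sup>2) - exp ((\<xi> p 0)\<^sup>2)) \<in> O(\<lambda>h. 1 / h)"
    by (rule bigo_diff_compose[where u = "\<lambda>x. exp (x\<^sup>2)", OF _ g \<xi>])
      (auto intro!: derivative_eq_intros)
  moreover have "(\<lambda>h. erf (\<xi> p (conv_term p h)) - erf (\<xi> p 0)) \<in> O(\<lambda>h. 1 / h)"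
    by (rule bigo_diff_compose[where u = erf, OF DERIV_erf[OF DERIV_ident] g \<xi>])
  ultimately show ?thesis
    unfolding \<mu>_def W_def
    by (intro bigo_diff_cmult bigo_diff_add bigo_diff_mult[OF g] \<xi> \<delta>)
qed

section \<open>Transfer of the rates to temperatures and free boundaries\<close>

theorem theorem4p1:
  fixes p :: params
    and \<theta>1 \<theta>2 :: "real \<Rightarrow> real \<Rightarrow> real \<Rightarrow> real" and s r :: "real \<Rightarrow> real \<Rightarrow> real"
    and \<theta>1inf \<theta>2inf :: "real \<Rightarrow> real \<Rightarrow> real" and sinf rinf :: "real \<Rightarrow> real"
  assumes "admissible p"
    and "\<And>h. h > h_star p \<Longrightarrow> similarity_solution_P p h (\<theta>1 h) (\<theta>2 h) (s h) (r h)"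
    and "similarity_solution_P_inf p \<theta>1inf \<theta>2inf sinf rinf"
  shows
    "(\<forall>x>0. \<forall>t>0. ((\<lambda>h. \<theta>1 h x t) \<longlongrightarrow> \<theta>1inf x t) at_top) \<and>
     (\<forall>x>0. \<forall>t>0. ((\<lambda>h. \<theta>2 h x t) \<longlongrightarrow> \<theta>2inf x t) at_top) \<and>
     (\<forall>t>0. ((\<lambda>h. s h t) \<longlongrightarrow> sinf t) at_top) \<and>
     (\<forall>t>0. ((\<lambda>h. r h t) \<longlongrightarrow> rinf t) at_top) \<and>
     (\<forall>x>0. \<forall>t>0. (\<lambda>h. \<theta>1 h x t - \<theta>1inf x t) \<in> O[at_top](\<lambda>h. 1 / h)) \<and>
     (\<forall>x>0. \<forall>t>0. (\<lambda>h. \<theta>2 h x t - \<theta>2inf x t) \<in> O[at_top](\<lambda>h. 1 / h)) \<and>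
     (\<forall>t>0. (\<lambda>h. s h t - sinf t) \<in> O[at_top](\<lambda>h. 1 / h)) \<and>
     (\<forall>t>0. (\<lambda>h. r h t - rinf t) \<in> O[at_top](\<lambda>h. 1 / h))"
proof -
  note p = assms(1)
  note g = inverse_at_top_tendsto
  define X where "X h = \<xi> p (conv_term p h)" for h
  define M where "M h = \<mu> p (conv_term p h)" for h
  define X0 where "X0 = \<xi> p 0"
  define M0 where "M0 = \<mu> p 0"
  have X: "(\<lambda>h. X h - X0) \<in> O(\<lambda>h. 1 / h)"
    unfolding X_def X0_def by (rule \<xi>_conv_term_bigo[OF p])
  have M: "(\<lambda>h. M h - M0) \<in> O(\<lambda>h. 1 / h)"
    unfolding M_def M0_def by (rule \<mu>_conv_term_bigo[OF p])
  have X0: "0 < X0" unfolding X0_def by (rule \<xi>_0[OF p])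
  have M0: "0 < M0"
    using W_pos[OF p order_refl X0] admissible_pos(3)[OF p] by (simp add: M0_def \<mu>_def X0_def)
  have erfX: "(\<lambda>h. erf (X h) - erf X0) \<in> O(\<lambda>h. 1 / h)"
    by (rule bigo_diff_compose[where u = erf, OF DERIV_erf[OF DERIV_ident] g X])
  have erf0: "erf X0 \<noteq> 0" "erf M0 \<noteq> 0" "erfc M0 \<noteq> 0"
    using X0 M0 erfc_pos[of M0] by (simp_all add: less_imp_neq[symmetric])
  have sol: "eventually (\<lambda>h. similarity_solution_P p h (\<theta>1 h) (\<theta>2 h) (s h) (r h)) at_top"
    using eventually_gt_at_top[of "h_star p"] by eventually_elim (rule assms(2))
  \<comment> \<open>The given solutions are explicit only beyond \<open>h_star p\<close>; an
    O-estimate at infinity may use the formulas instead.\<close>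
  have eq: "(\<lambda>h. f h - a) \<in> O(\<lambda>h. 1 / h)"
    if "eventually (\<lambda>h. f h = f' h) at_top" "(\<lambda>h. f' h - a) \<in> O(\<lambda>h. 1 / h)"
    for f f' :: "real \<Rightarrow> real" and a
    using that(1) by (intro landau_o.big.in_cong[THEN iffD2, OF _ that(2)]) (auto elim: eventually_mono)
  have 1: "(\<lambda>h. \<theta>1 h x t - \<theta>1inf x t) \<in> O(\<lambda>h. 1 / h)" if "0 < x" "0 < t" for x t
  proof (rule eq)
    let ?A = "erf (x / (2 * sqrt (\<alpha>\<^sub>1 p * t)))"
    show "eventually (\<lambda>h. \<theta>1 h x t = - D p * (erf (X h) / (erf (X h) + conv_term p h) * (1 - ?A / erf (X h)))) at_top"
      using sol by eventually_elim
        (use that in \<open>simp add: similarity_solution_P_def Let_def X_def conv_term_def mult.commute\<close>)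
    \<comment> \<open>The summand 0 stands for the limit of \<open>conv_term p h\<close>, giving
      both formulas the same shape.\<close>
    have inf: "\<theta>1inf x t = - D p * (erf X0 / (erf X0 + 0) * (1 - ?A / erf X0))"
      using assms(3) that erf0 by (simp add: similarity_solution_P_inf_def Let_def X0_def)
    have "(\<lambda>h. (1 - ?A / erf (X h)) - (1 - ?A / erf X0)) \<in> O(\<lambda>h. 1 / h)"
      by (rule bigo_diff_compose[where u = "\<lambda>y. 1 - ?A / y", OF _ g erfX])
        (use erf0 in \<open>auto intro!: derivative_eq_intros\<close>)
    note v = this
    have \<delta>: "(\<lambda>h. conv_term p h - 0) \<in> O(\<lambda>h. 1 / h)"
      using conv_term_bigo by simp
    show "(\<lambda>h. - D p * (erf (X h) / (erf (X h) + conv_term p h) * (1 - ?A / erf (X h))) - \<theta>1inf x t)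
        \<in> O(\<lambda>h. 1 / h)"
      unfolding inf
      by (intro bigo_diff_cmult bigo_diff_mult[OF g] bigo_diff_divide[OF g] bigo_diff_add erfX v \<delta>) (use erf0 in simp)
  qed
  have 2: "(\<lambda>h. \<theta>2 h x t - \<theta>2inf x t) \<in> O(\<lambda>h. 1 / h)" if "0 < x" "0 < t" for x t
  proof (rule eq)
    \<comment> \<open>The second temperature depends on \<open>h\<close> only through
      \<open>M h\<close>, so differentiability of one function at \<open>M0\<close>
      suffices.\<close>
    let ?u = "\<lambda>m. \<theta>\<^sub>0 p * erf m / erfc m * (erf (x / (2 * sqrt (\<alpha>\<^sub>2 p * t))) / erf m - 1)"
    show "eventually (\<lambda>h. \<theta>2 h x t = ?u (M h)) at_top"
      using sol by eventually_elim (use that in \<open>simp add: similarity_solution_P_def Let_def M_def\<close>)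
    have inf: "\<theta>2inf x t = ?u M0"
      using assms(3) that by (simp add: similarity_solution_P_inf_def Let_def M0_def)
    show "(\<lambda>h. ?u (M h) - \<theta>2inf x t) \<in> O(\<lambda>h. 1 / h)"
      unfolding inf
      by (rule bigo_diff_compose[where u = ?u, OF _ g M])
        (use erf0 in \<open>auto intro!: derivative_eq_intros\<close>)
  qed
  have 3: "(\<lambda>h. s h t - sinf t) \<in> O(\<lambda>h. 1 / h)" if "0 < t" for t
  proof (rule eq)
    show "eventually (\<lambda>h. s h t = (2 * sqrt (\<alpha>\<^sub>1 p * t)) * X h) at_top"
      using sol by eventually_elim (use that in \<open>simp add: similarity_solution_P_def Let_def X_def\<close>)
    have inf: "sinf t = (2 * sqrt (\<alpha>\<^sub>1 p * t)) * X0"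
      using assms(3) that by (simp add: similarity_solution_P_inf_def Let_def X0_def)
    show "(\<lambda>h. (2 * sqrt (\<alpha>\<^sub>1 p * t)) * X h - sinf t) \<in> O(\<lambda>h. 1 / h)"
      unfolding inf by (rule bigo_diff_cmult[OF X])
  qed
  have 4: "(\<lambda>h. r h t - rinf t) \<in> O(\<lambda>h. 1 / h)" if "0 < t" for t
  proof (rule eq)
    show "eventually (\<lambda>h. r h t = (2 * sqrt (\<alpha>\<^sub>2 p * t)) * M h) at_top"
      using sol by eventually_elim (use that in \<open>simp add: similarity_solution_P_def Let_def M_def\<close>)
    have inf: "rinf t = (2 * sqrt (\<alpha>\<^sub>2 p * t)) * M0"
      using assms(3) that by (simp add: similarity_solution_P_inf_def Let_def M0_def)
    show "(\<lambda>h. (2 * sqrt (\<alpha>\<^sub>2 p * t)) * M h - rinf t) \<in> O(\<lambda>h. 1 / h)"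
      unfolding inf by (rule bigo_diff_cmult[OF M])
  qed
  show ?thesis
    by (intro conjI allI impI 1 2 3 4 bigo_imp_tendsto[OF g 1] bigo_imp_tendsto[OF g 2]
        bigo_imp_tendsto[OF g 3] bigo_imp_tendsto[OF g 4])
qed

end
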